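(* Let $g\in L^2(\mathbb{R}^m)$ and let $\Lambda$ be a countable family of points of $\mathbb{R}^{2m}$ (repetitions allowed) such that the Gabor set $\mathcal{G}(g,\Lambda)$ is a frame for $L^2(\mathbb{R}^m)$. Fix $O\in\mathbb{R}^{2m}$ and an invertible matrix $M\in\mathbb{R}^{2m\times2m}$, and set $\Lambda_n=\Lambda\cap MQ_n(O)$. Then $(\Lambda,\|\cdot\|_\infty,(\Lambda_n)_n)$ is a uniform metric index set.
   Context: For $\lambda=(t,\omega)\in\mathbb{R}^m\times\mathbb{R}^m$ and a phase $\varphi_\lambda\in\mathbb{R}$, $g_\lambda(x)=e^{i\varphi_\lambda}e^{2\pi i\langle\omega,x\rangle}g(x-t)$; $\mathcal{G}(g,\Lambda)=\{g_\lambda\}_{\lambda\in\Lambda}$ (for an arbitrary fixed choice of phases). $Q_n(c)=\{\lambda\in\mathbb{R}^{2m}:\|\lambda-c\|_\infty\le n/2\}$. The index set $\Lambda$ carries the quasi-distance $d(\lambda,\lambda')=\|\lambda-\lambda'\|_\infty$ (a quasi-distance: nonnegative, $d(\lambda,\lambda)=0$, symmetric, triangle inequality; distinct indices may have distance $0$), with balls $B_R(\lambda)=\{\lambda'\in\Lambda:d(\lambda',\lambda)\le R\}$; $\Lambda_n$ consists of the indices whose points lie in $MQ_n(O)$. A triple $(K,d,(K_n))$ with $K$ countable, $(K_n)$ nested finite subsets covering $K$, is a uniform metric index set if $\sup_{k}|B_R(k)|<\infty$ and $\lim_n|(\bigcup_{j\in K\setminus K_n}B_R(j))\cap K_n|/|K_n|=0$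 for all $R>0$. *)

theory Defs
  imports "HOL-Analysis.Analysis"
begin

text \<open>Points of the time-frequency plane R^{2m} are pairs (t, omega) of vectors in R^m.\<close>

definition supnorm_tf :: "(real^'m) \<times> (real^'m) \<Rightarrow> real" where
  "supnorm_tf p = max (Max (range (\<lambda>i. \<bar>fst p $ i\<bar>))) (Max (range (\<lambda>i. \<bar>snd p $ i\<bar>)))"

definition cubeQ :: "nat \<Rightarrow> (real^'m) \<times> (real^'m) \<Rightarrow> ((real^'m) \<times> (real^'m)) set" where
  "cubeQ n c = {lam. supnorm_tf (lam - c) \<le> real n / 2}"

definition L2 :: "(real^'m \<Rightarrow> complex) \<Rightarrow> bool" where
  "L2 f \<longleftrightarrow> f \<in> borel_measurable lebesgue \<and> integrable lebesgue (\<lambda>x. (cmod (f x))\<^sup>2)"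

definition L2_inner :: "(real^'m \<Rightarrow> complex) \<Rightarrow> (real^'m \<Rightarrow> complex) \<Rightarrow> complex" where
  "L2_inner f h = (LINT x|lebesgue. f x * cnj (h x))"

definition L2_normsq :: "(real^'m \<Rightarrow> complex) \<Rightarrow> real" where
  "L2_normsq f = (LINT x|lebesgue. (cmod (f x))\<^sup>2)"

definition tf_shift :: "real \<Rightarrow> (real^'m) \<times> (real^'m) \<Rightarrow> (real^'m \<Rightarrow> complex) \<Rightarrow> (real^'m \<Rightarrow> complex)" where
  "tf_shift phi lam g = (\<lambda>x. cis phi * cis (2 * pi * (snd lam \<bullet> x)) * g (x - fst lam))"

definition is_frame_L2 :: "'k set \<Rightarrow> ('k \<Rightarrow> (real^'m \<Rightarrow> complex)) \<Rightarrow> bool" where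
  "is_frame_L2 K e \<longleftrightarrow> (\<forall>k\<in>K. L2 (e k)) \<and>
     (\<exists>A B. 0 < A \<and> A \<le> B \<and>
       (\<forall>f. L2 f \<longrightarrow>
          (\<lambda>k. (cmod (L2_inner f (e k)))\<^sup>2) summable_on K \<and>
          A * L2_normsq f \<le> (\<Sum>\<^sub>\<infinity>k\<in>K. (cmod (L2_inner f (e k)))\<^sup>2) \<and>
          (\<Sum>\<^sub>\<infinity>k\<in>K. (cmod (L2_inner f (e k)))\<^sup>2) \<le> B * L2_normsq f))"

text \<open>Gabor system G(g, Lambda), Lambda given as an indexed family pt : K -> R^{2m}.\<close>
definition gabor_system :: "('k \<Rightarrow> real) \<Rightarrow> ('k \<Rightarrow> (real^'m) \<times> (real^'m)) \<Rightarrow> (real^'m \<Rightarrow> complex) \<Rightarrow> 'k \<Rightarrow> (real^'m \<Rightarrow> complex)" where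
  "gabor_system phi pt g = (\<lambda>k. tf_shift (phi k) (pt k) g)"

definition ball_idx :: "'k set \<Rightarrow> ('k \<Rightarrow> 'k \<Rightarrow> real) \<Rightarrow> real \<Rightarrow> 'k \<Rightarrow> 'k set" where
  "ball_idx K d R k = {k' \<in> K. d k' k \<le> R}"

definition quasi_distance_on :: "'k set \<Rightarrow> ('k \<Rightarrow> 'k \<Rightarrow> real) \<Rightarrow> bool" where
  "quasi_distance_on K d \<longleftrightarrow>
     (\<forall>k\<in>K. \<forall>k'\<in>K. 0 \<le> d k k' \<and> d k k' = d k' k) \<and> (\<forall>k\<in>K. d k k = 0) \<and>
     (\<forall>k1\<in>K. \<forall>k2\<in>K. \<forall>k3\<in>K. d k1 k3 \<le> d k1 k2 + d k2 k3)"

definition uniform_metric_index_set :: "'k set \<Rightarrow> ('k \<Rightarrow> 'k \<Rightarrow> real) \<Rightarrow> (nat \<Rightarrow> 'k set) \<Rightarrow> bool" where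
  "uniform_metric_index_set K d Kn \<longleftrightarrow>
     countable K \<and> quasi_distance_on K d \<and>
     (\<forall>n. finite (Kn n) \<and> Kn n \<subseteq> Kn (Suc n)) \<and> (\<Union>n. Kn n) = K \<and>
     (\<forall>R>0. (\<exists>C::nat. \<forall>k\<in>K. finite (ball_idx K d R k) \<and> card (ball_idx K d R k) \<le> C) \<and>
        (\<lambda>n. real (card ((\<Union>j\<in>K - Kn n. ball_idx K d R j) \<inter> Kn n)) / real (card (Kn n)))
          \<longlonglongrightarrow> 0)"

end

(*
  With f the indicator function of [0,1)^m and V(u) = <f_u, g>, one has |<f_z, g_lambda>| = |V(z - lambda)|,
  so the frame inequality for the time-frequency shifts f_z reads
    A <= sum_lambda |V(z - lambda)|^2 <= B   for every point z.
  The integer time-frequency shifts of f are orthonormal; integrating Bessel's inequality over a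
  unit cell shows that V is square integrable.  Averaging the upper bound over z in a ball bounds the
  number of points in balls of a given radius.  Averaging the lower bound over a unit ball whose
  surroundings contain no points would bound A times its volume by a tail of the integral of |V|^2,
  so the points are relatively dense.

  For the boundary condition no volume asymptotics are needed: points in the boundary shell of a large
  cube are pushed radially inwards by J different depths to nearby index points.  Different depths give
  disjoint images and each depth has uniformly bounded fibres, so the shell contains at most a
  constant over J times the number of points in the cube.
*)

theory Submission
  imports Defs
begin

section \<open>Shells of relatively dense, uniformly locally finite families\<close>

lemma card_fibres_le:
  assumes "finite A" "finite B" "f ` A \<subseteq> B" "\<And>b. b \<in> B \<Longrightarrow> card {a \<in> A. f a = b} \<le> C"
  shows "card A \<le> C * card B"
proof -
  have "A = (\<Union>b\<in>B. {a \<in> A. f a = b})" using assms(3) by auto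
  then have "card A \<le> (\<Sum>b\<in>B. card {a \<in> A. f a = b})"
    using card_UN_le[OF assms(2), of "\<lambda>b. {a \<in> A. f a = b}"] by simp
  also have "\<dots> \<le> (\<Sum>b\<in>B. C)" by (intro sum_mono assms(4))
  finally show ?thesis by (simp add: mult.commute)
qed

text \<open>The radial push with explicit constants, for any seminorm \<open>N\<close>. Contraction
  factors stay at least 1/2 because all \<open>J\<close> depths together use up at most half of
  \<open>h\<close>; undoing a contraction therefore at most doubles distances, which is why
  \<open>C\<close> counts indices within \<open>4 * r\<close>.\<close>

lemma card_shell_le:
  fixes N :: "'a::real_vector \<Rightarrow> real" and q :: "'k \<Rightarrow> 'a"
  assumes tri: "\<And>x y. N (x + y) \<le> N x + N y"
    and hom: "\<And>a x. N (a *\<^sub>R x) = \<bar>a\<bar> * N x"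
    and fin: "\<And>R z. finite {k \<in> K. N (q k - z) \<le> R}"
    and cnt: "\<And>z. card {k \<in> K. N (q k - z) \<le> 4 * r} \<le> C"
    and dense: "\<And>z. \<exists>k\<in>K. N (q k - z) \<le> r"
    and "0 \<le> R" "0 < h" and h: "2 * real J * (R + 2 * r) \<le> h"
  shows "J * card {k \<in> K. h - R < N (q k - c) \<and> N (q k - c) \<le> h}
           \<le> C * card {k \<in> K. N (q k - c) \<le> h}"
proof -
  define S where "S = {k \<in> K. h - R < N (q k - c) \<and> N (q k - c) \<le> h}"
  define L where "L = {k \<in> K. N (q k - c) \<le> h}"
  \<comment> \<open>Spacing of the depths: the shell thickness \<open>R\<close> plus an error
    \<open>r\<close> on either side from moving to an index point.\<close>
  define D where "D = R + 2 * r"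
  \<comment> \<open>The factor that moves level \<open>h\<close> down to level
    \<open>h - j * D\<close>.\<close>
  define s where "s j = 1 - real j * D / h" for j :: nat
  define \<sigma> where "\<sigma> = (\<lambda>(j, k). SOME l. l \<in> K \<and> N (q l - (c + s j *\<^sub>R (q k - c))) \<le> r)"
  have N_minus: "N (x - y) = N (y - x)" for x y
    using hom[of "-1" "x - y"] by simp
  have N_ge0: "0 \<le> N x" for x
    using tri[of x "- x"] hom[of 0 x] hom[of "-1" x] by simp
  have r: "0 \<le> r" using dense[of c] N_ge0 order_trans by blast
  then have D: "0 \<le> D" "r \<le> D" using \<open>0 \<le> R\<close> by (auto simp: D_def)
  have finL: "finite L" unfolding L_def by (rule fin)
  have finS: "finite S" by (rule finite_subset[OF _ finL]) (auto simp: S_def L_def)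
  have \<sigma>: "\<sigma> (j, k) \<in> K" "N (q (\<sigma> (j, k)) - (c + s j *\<^sub>R (q k - c))) \<le> r" for j k
    using someI_ex[of "\<lambda>l. l \<in> K \<and> N (q l - (c + s j *\<^sub>R (q k - c))) \<le> r"] dense
    unfolding \<sigma>_def by auto
  have s: "1/2 \<le> s j" "s j \<le> 1" "s j * h = h - j * D" if "j \<in> {1..J}" for j
  proof -
    have "2 * (j * D) \<le> 2 * (J * D)"
      using that D by (intro mult_left_mono mult_right_mono) auto
    then have "2 * (j * D) \<le> h" using h by (simp add: D_def mult.assoc)
    then show "1/2 \<le> s j" using \<open>0 < h\<close> by (simp add: s_def field_simps)
    show "s j \<le> 1" using D \<open>0 < h\<close> by (simp add: s_def)
    show "s j * h = h - j * D" using \<open>0 < h\<close> by (simp add: s_def field_simps)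
  qed
  \<comment> \<open>The factor is at most 1, so the contracted shell is no thicker than
    \<open>R\<close>; replacing a contracted point by a nearby index costs \<open>r\<close> at each
    end.\<close>
  have bounds: "h - j * D - R - r < N (q (\<sigma> (j, k)) - c)" "N (q (\<sigma> (j, k)) - c) \<le> h - j * D + r"
    if "j \<in> {1..J}" "k \<in> S" for j k
  proof -
    note sj = s[OF that(1)]
    let ?x = "q k - c" and ?y = "q (\<sigma> (j, k)) - c"
    have yx: "N (?y - s j *\<^sub>R ?x) \<le> r" using \<sigma>(2)[of j k] by (simp add: algebra_simps)
    have Nx: "h - R < N ?x" "N ?x \<le> h" using that(2) by (auto simp: S_def)
    have hs: "N (s j *\<^sub>R ?x) = s j * N ?x" using sj by (simp add: hom)
    have "s j * N ?x \<le> s j * h" using Nx sj by (intro mult_left_mono) auto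
    moreover have "s j * (h - R) < s j * N ?x" using Nx sj by (intro mult_strict_left_mono) auto
    moreover have "s j * R \<le> R" using sj \<open>0 \<le> R\<close> by (simp add: mult_left_le_one_le)
    moreover have "N ?y \<le> N (?y - s j *\<^sub>R ?x) + N (s j *\<^sub>R ?x)"
      using tri[of "?y - s j *\<^sub>R ?x" "s j *\<^sub>R ?x"] by simp
    moreover have "N (s j *\<^sub>R ?x) \<le> N (?y - s j *\<^sub>R ?x) + N ?y"
      using tri[of "s j *\<^sub>R ?x - ?y" "?y"] N_minus[of "s j *\<^sub>R ?x" ?y] by simp
    ultimately show "h - j * D - R - r < N ?y" "N ?y \<le> h - j * D + r"
      using yx hs sj by (auto simp: right_diff_distrib)
  qed
  have "card ({1..J} \<times> S) \<le> C * card L"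
  proof (rule card_fibres_le[where f = \<sigma>])
    show "\<sigma> ` ({1..J} \<times> S) \<subseteq> L"
    proof safe
      fix j k assume j: "j \<in> {1..J}" and k: "k \<in> S"
      \<comment> \<open>Depths start at 1, not 0: the push by at least \<open>D\<close> compensates
        the error \<open>r\<close> and keeps the image in the cube.\<close>
      have "1 * D \<le> real j * D" using j D by (intro mult_right_mono) auto
      then have "N (q (\<sigma> (j, k)) - c) \<le> h" using bounds(2)[OF j k] D by simp
      then show "\<sigma> (j, k) \<in> L" using \<sigma>(1) by (simp add: L_def)
    qed
  next
    fix l assume "l \<in> L"
    let ?F = "{a \<in> {1..J} \<times> S. \<sigma> a = l}"
    show "card ?F \<le> C"
    proof (cases "?F = {}")
      case False
      then obtain j k where jk: "j \<in> {1..J}" "k \<in> S" "\<sigma> (j, k) = l" by auto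
      have "?F \<subseteq> Pair j ` {k' \<in> K. N (q k' - q k) \<le> 4 * r}"
      proof
        fix a assume "a \<in> ?F"
        then obtain j' k' where a: "a = (j', k')" and jk': "j' \<in> {1..J}" "k' \<in> S" "\<sigma> (j', k') = l"
          by auto
        \<comment> \<open>The level ranges of consecutive depths abut:
          \<open>h - i * D - R - r\<close> equals \<open>h - (i + 1) * D + r\<close>. The strict
          lower bound excludes a common image.\<close>
        have gap: "\<not> i < i'" if "i \<in> {1..J}" "i' \<in> {1..J}" "k \<in> S" "k' \<in> S" "\<sigma> (i, k) = \<sigma> (i', k')" for i i' k k'
        proof
          assume "i < i'"
          then have "(real i + 1) * D \<le> real i' * D" using D by (intro mult_right_mono) auto
          then show False
            using bounds(1)[OF that(1,3)] bounds(2)[OF that(2,4)] that(5)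
            by (simp add: D_def algebra_simps)
        qed
        have "j' = j" using gap[OF jk(1) jk'(1) jk(2) jk'(2)] gap[OF jk'(1) jk(1) jk'(2) jk(2)] jk(3) jk'(3)
          by simp
        \<comment> \<open>In one fibre both contracted points lie within \<open>r\<close> of
          \<open>q l\<close>, hence within \<open>2 * r\<close> of each other.\<close>
        have "N (s j *\<^sub>R (q k' - q k)) \<le> N (q l - (c + s j *\<^sub>R (q k - c))) + N ((c + s j *\<^sub>R (q k' - c)) - q l)"
          using tri[of "q l - (c + s j *\<^sub>R (q k - c))" "(c + s j *\<^sub>R (q k' - c)) - q l"]
          by (simp add: algebra_simps)
        also have "\<dots> \<le> r + r"
          using \<sigma>(2)[of j k] \<sigma>(2)[of j k'] jk(3) jk'(3) \<open>j' = j\<close> N_minus[of "q l"] by (intro add_mono) auto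
        finally have "s j * N (q k' - q k) \<le> 2 * r" using s[OF jk(1)] by (simp add: hom)
        moreover have "1/2 * N (q k' - q k) \<le> s j * N (q k' - q k)"
          using s[OF jk(1)] N_ge0 by (intro mult_right_mono) auto
        ultimately have "N (q k' - q k) \<le> 4 * r" by simp
        then show "a \<in> Pair j ` {k' \<in> K. N (q k' - q k) \<le> 4 * r}"
          using a \<open>j' = j\<close> jk'(2) by (auto simp: S_def)
      qed
      then have "card ?F \<le> card (Pair j ` {k' \<in> K. N (q k' - q k) \<le> 4 * r})"
        by (intro card_mono finite_imageI fin)
      also have "\<dots> \<le> card {k' \<in> K. N (q k' - q k) \<le> 4 * r}" by (intro card_image_le fin)
      also have "\<dots> \<le> C" by (rule cnt)
      finally show ?thesis .
    next
      case True
      show ?thesis unfolding True by simp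
    qed
  qed (use finS finL in auto)
  then show ?thesis by (simp add: S_def L_def card_cartesian_product)
qed

text \<open>The constant \<open>C\<close> of the shell estimate does not depend on the number
  \<open>J\<close> of depths. Hence \<open>J\<close> may be chosen after \<open>C\<close> to make
  \<open>C / J\<close> smaller than \<open>e\<close>, and only then is the cube taken large.\<close>

lemma shell_ratio_tendsto_0:
  fixes N :: "'a::real_vector \<Rightarrow> real" and q :: "'k \<Rightarrow> 'a"
  assumes tri: "\<And>x y. N (x + y) \<le> N x + N y"
    and hom: "\<And>a x. N (a *\<^sub>R x) = \<bar>a\<bar> * N x"
    and cnt: "\<And>R. \<exists>C. \<forall>z. finite {k \<in> K. N (q k - z) \<le> R} \<and> card {k \<in> K. N (q k - z) \<le> R} \<le> C"
    and dense: "\<exists>r. \<forall>z. \<exists>k\<in>K. N (q k - z) \<le> r"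
    and "0 \<le> R"
  shows "(\<lambda>n. real (card {k \<in> K. real n / 2 - R < N (q k - c) \<and> N (q k - c) \<le> real n / 2})
            / real (card {k \<in> K. N (q k - c) \<le> real n / 2})) \<longlonglongrightarrow> 0"
    (is "(\<lambda>n. real (?S n) / real (?L n)) \<longlonglongrightarrow> 0")
proof (rule LIMSEQ_I)
  fix e :: real assume "0 < e"
  obtain r where r: "\<And>z. \<exists>k\<in>K. N (q k - z) \<le> r" using dense by blast
  obtain C where C: "\<And>z. card {k \<in> K. N (q k - z) \<le> 4 * r} \<le> C" using cnt by blast
  have fin: "finite {k \<in> K. N (q k - z) \<le> R}" for R z using cnt by blast
  obtain J where J: "real C / e < real J" using reals_Archimedean2 by blast
  then have "0 < real J" using \<open>0 < e\<close> by (meson divide_nonneg_pos of_nat_0_le_iff order_le_less_trans)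
  \<comment> \<open>With half-side \<open>h = n / 2\<close>, the condition for fitting
    \<open>J\<close> depths becomes \<open>4 * J * (R + 2 * r) \<le> n\<close>.\<close>
  obtain n0 where n0: "4 * real J * (R + 2 * r) + 1 \<le> real n0" using real_arch_simple by blast
  have "norm (real (?S n) / real (?L n) - 0) < e" if "Suc n0 \<le> n" for n
  proof -
    have "real n0 \<le> real n" using that by simp
    then have "4 * real J * (R + 2 * r) \<le> real n" using n0 by linarith
    then have "2 * real J * (R + 2 * r) \<le> real n / 2" by (simp add: field_simps)
    moreover have "0 < real n / 2" using that by simp
    ultimately have "J * ?S n \<le> C * ?L n"
      using card_shell_le[where N = N and q = q and h = "real n / 2" and J = J and c = c, OF tri hom fin C r \<open>0 \<le> R\<close>] by blast
    then have le: "real J * real (?S n) \<le> real C * real (?L n)"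
      unfolding of_nat_mult[symmetric] of_nat_le_iff .
    show ?thesis
    \<comment> \<open>For an empty cube the quotient is 0 by the convention for division by
      zero.\<close>
    proof (cases "?L n = 0")
      case False
      then have "real (?S n) / real (?L n) \<le> real C / real J"
        using le \<open>0 < real J\<close> by (simp add: field_simps)
      also have "\<dots> < e" using J \<open>0 < e\<close> \<open>0 < real J\<close> by (simp add: field_simps)
      finally show ?thesis by simp
    qed (use \<open>0 < e\<close> in simp)
  qed
  then show "\<exists>n0. \<forall>n\<ge>n0. norm (real (?S n) / real (?L n) - 0) < e" by blast
qed

section \<open>Point counts from two-sided bounds on translated sums\<close>

lemma nn_integral_lborel_translate:
  fixes a :: "'a::euclidean_space"
  assumes [measurable]: "f \<in> borel_measurable borel"
  shows "(\<integral>\<^sup>+x. f (a + x) \<partial>lborel) = (\<integral>\<^sup>+x. f x \<partial>lborel)"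
proof -
  have "(\<integral>\<^sup>+x. f x \<partial>lborel) = (\<integral>\<^sup>+x. f x \<partial>distr lborel borel ((+) a))"
    by (simp add: lborel_distr_plus)
  also have "\<dots> = (\<integral>\<^sup>+x. f (a + x) \<partial>lborel)" by (subst nn_integral_distr) auto
  finally show ?thesis ..
qed

lemma sum_le_nn_integral_count_space:
  fixes f :: "'a \<Rightarrow> ennreal"
  assumes "finite F" "F \<subseteq> K"
  shows "sum f F \<le> (\<integral>\<^sup>+k. f k \<partial>count_space K)"
proof -
  have "sum f F = (\<integral>\<^sup>+k. f k \<partial>count_space F)"
    using assms by (simp add: nn_integral_count_space_finite)
  also have "\<dots> = (\<integral>\<^sup>+k. f k * indicator F k \<partial>count_space K)"
    using assms(2) by (auto simp: nn_integral_count_space_indicator indicator_def intro!: nn_integral_cong)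
  also have "\<dots> \<le> (\<integral>\<^sup>+k. f k \<partial>count_space K)"
    by (intro nn_integral_mono) (auto simp: indicator_def)
  finally show ?thesis .
qed

lemma finite_card_le_if_finite_subsets:
  assumes "\<And>F. finite F \<Longrightarrow> F \<subseteq> S \<Longrightarrow> card F \<le> C"
  shows "finite S \<and> card S \<le> C"
proof -
  have "finite S"
  proof (rule ccontr)
    assume "infinite S"
    then obtain F where "F \<subseteq> S" "finite F" "card F = Suc C"
      using infinite_arbitrarily_large by blast
    with assms[of F] show False by simp
  qed
  then show ?thesis using assms by blast
qed

text \<open>Integrate the upper bound over a slightly larger ball: every index point in the given
  ball contributes the same mass \<open>?a\<close> of \<open>W\<close>, while the total is at most
  \<open>B\<close> times a volume. The lower bound serves to make \<open>?a\<close> positive.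
  Writing sums as integrals over \<open>count_space\<close> allows exchanging them with integrals
  over space.\<close>

lemma uniformly_locally_finite_if_bounded_sum:
  fixes W :: "'a::euclidean_space \<Rightarrow> ennreal" and pt :: "'k \<Rightarrow> 'a"
  assumes W [measurable]: "W \<in> borel_measurable borel"
    and int: "(\<integral>\<^sup>+v. W v \<partial>lborel) < \<infinity>"
    and K: "countable K" and "0 < A" and "B < \<infinity>"
    and lower: "\<And>z. A \<le> (\<integral>\<^sup>+k. W (z - pt k) \<partial>count_space K)"
    and upper: "\<And>z. (\<integral>\<^sup>+k. W (z - pt k) \<partial>count_space K) \<le> B"
  shows "\<exists>C::nat. \<forall>z. finite {k \<in> K. dist (pt k) z \<le> R} \<and> card {k \<in> K. dist (pt k) z \<le> R} \<le> C"
proof -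
  have shift: "(\<integral>\<^sup>+v. f (v - p) \<partial>lborel) = (\<integral>\<^sup>+v. f v \<partial>lborel)"
    if "f \<in> borel_measurable borel" for f and p :: 'a
    using nn_integral_lborel_translate[OF that, of "- p"] by simp
  have [measurable]: "cball x r \<in> sets borel" for x :: 'a and r by simp
  \<comment> \<open>If no ball carried mass, \<open>W\<close> would vanish almost everywhere;
    exchanging sum and integral would then make the integral of the constant \<open>A\<close> over
    the whole space zero.\<close>
  obtain n :: nat where n: "0 < (\<integral>\<^sup>+v. W v * indicator (cball 0 (real n)) v \<partial>lborel)"
  proof (rule ccontr)
    assume "\<not> thesis"
    with that have "(\<integral>\<^sup>+v. W v * indicator (cball 0 (real n)) v \<partial>lborel) = 0" for n :: nat
      using not_gr_zero by blast
    then have "AE v in lborel. W v * indicator (cball 0 (real n)) v = 0" for n :: nat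
      by (subst (asm) nn_integral_0_iff_AE) measurable
    then have "AE v in lborel. \<forall>n::nat. W v * indicator (cball 0 (real n)) v = 0"
      unfolding AE_all_countable by blast
    then have ae: "AE v in lborel. W v = 0"
    proof eventually_elim
      case (elim v)
      obtain n where "norm v \<le> real n" using real_arch_simple by blast
      with elim[rule_format, of n] show ?case by (simp add: indicator_def)
    qed
    have int0: "(\<integral>\<^sup>+v. W v \<partial>lborel) = 0"
      using ae by (subst nn_integral_0_iff_AE) auto
    have "(\<integral>\<^sup>+v. A \<partial>(lborel::'a measure)) \<le> (\<integral>\<^sup>+v. \<integral>\<^sup>+k. W (v - pt k) \<partial>count_space K \<partial>lborel)"
      by (intro nn_integral_mono lower)
    also have "\<dots> = (\<integral>\<^sup>+k. \<integral>\<^sup>+v. W (v - pt k) \<partial>lborel \<partial>count_space K)"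
      using K by (subst nn_integral_count_space_nn_integral) auto
    also have "\<dots> = 0" by (simp add: shift int0)
    finally show False using \<open>0 < A\<close> by (simp add: ennreal_mult_eq_top_iff)
  qed
  let ?a = "\<integral>\<^sup>+v. W v * indicator (cball 0 (real n)) v \<partial>lborel"
  let ?b = "B * emeasure lborel (cball (0::'a) (R + real n))"
  have "?b < \<infinity>"
    using \<open>B < \<infinity>\<close> emeasure_lborel_cball_finite[of "0::'a" "R + real n"]
    by (simp add: ennreal_mult_less_top)
  have bound: "of_nat (card F) * ?a \<le> ?b"
    if F: "finite F" "F \<subseteq> {k \<in> K. dist (pt k) z \<le> R}" for F z
  proof -
    have ind: "indicator (cball 0 (real n)) (v - pt k) \<le> (indicator (cball z (R + real n)) v :: ennreal)"
      if "k \<in> F" for k v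
    proof -
      have "dist (pt k) z \<le> R" using F that by auto
      then have "dist z v \<le> R + real n" if "dist 0 (v - pt k) \<le> real n"
        using dist_triangle[of z v "pt k"] that by (simp add: dist_norm norm_minus_commute)
      then show ?thesis by (auto simp: indicator_def)
    qed
    have "of_nat (card F) * ?a = (\<Sum>k\<in>F. \<integral>\<^sup>+v. W (v - pt k) * indicator (cball 0 (real n)) (v - pt k) \<partial>lborel)"
      by (subst shift) auto
    also have "\<dots> \<le> (\<Sum>k\<in>F. \<integral>\<^sup>+v. W (v - pt k) * indicator (cball z (R + real n)) v \<partial>lborel)"
      by (intro sum_mono nn_integral_mono mult_left_mono ind) auto
    also have "\<dots> = (\<integral>\<^sup>+v. (\<Sum>k\<in>F. W (v - pt k)) * indicator (cball z (R + real n)) v \<partial>lborel)"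
      by (subst nn_integral_sum[symmetric]) (auto simp: sum_distrib_right)
    also have "\<dots> \<le> (\<integral>\<^sup>+v. B * indicator (cball z (R + real n)) v \<partial>lborel)"
    proof (intro nn_integral_mono mult_right_mono)
      fix v
      have "(\<Sum>k\<in>F. W (v - pt k)) \<le> (\<integral>\<^sup>+k. W (v - pt k) \<partial>count_space K)"
        using F by (intro sum_le_nn_integral_count_space) auto
      then show "(\<Sum>k\<in>F. W (v - pt k)) \<le> B" using upper order_trans by blast
    qed auto
    also have "\<dots> = B * emeasure lborel (cball z (R + real n))"
      by (subst nn_integral_cmult_indicator) auto
    \<comment> \<open>\<open>R\<close> is arbitrary, so the radius may be negative; both balls are
      empty in that case.\<close>
    also have "emeasure lborel (cball z (R + real n)) = emeasure lborel (cball (0::'a) (R + real n))"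
      by (cases "0 \<le> R + real n") (simp_all add: emeasure_cball)
    finally show ?thesis .
  qed
  \<comment> \<open>Integrability of \<open>W\<close> makes \<open>?a\<close> finite, so that
    \<open>?b / ?a\<close> can be compared with a natural number \<open>C\<close> and multiplied
    back.\<close>
  have "?a \<le> (\<integral>\<^sup>+v. W v \<partial>lborel)"
    by (intro nn_integral_mono) (auto simp: indicator_def)
  then have a: "?a \<noteq> 0" "?a < top" using n int by auto
  then have "?b / ?a < top" using \<open>?b < \<infinity>\<close>
    unfolding infinity_ennreal_def less_top[symmetric] ennreal_divide_eq_top_iff by simp
  then obtain C :: nat where "?b / ?a < of_nat C" using ennreal_Ex_less_of_nat by blast
  then have C: "?b < of_nat C * ?a" using divide_less_ennreal[OF a] by simp
  have "card F \<le> C" if F: "finite F" "F \<subseteq> {k \<in> K. dist (pt k) z \<le> R}" for F z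
  proof (rule ccontr)
    assume "\<not> card F \<le> C"
    then have "of_nat C * ?a \<le> of_nat (card F) * ?a" by (intro mult_right_mono) auto
    also have "\<dots> \<le> ?b" by (rule bound[OF F])
    finally show False using C by simp
  qed
  then have "finite {k \<in> K. dist (pt k) z \<le> R} \<and> card {k \<in> K. dist (pt k) z \<le> R} \<le> C" for z
    by (rule finite_card_le_if_finite_subsets)
  then show ?thesis by blast
qed

text \<open>Exchanging sum and integral puts the overlap count under one integral of
  \<open>W\<close>: for fixed \<open>v\<close>, at most \<open>C\<close> translates
  \<open>v + pt k\<close> fall into the unit ball around \<open>z\<close>, and none does while
  \<open>norm v < n\<close> if all points are farther than \<open>n + 1\<close> from
  \<open>z\<close>.\<close>

lemma relatively_dense_if_sum_bounded_below:
  fixes W :: "'a::euclidean_space \<Rightarrow> ennreal" and pt :: "'k \<Rightarrow> 'a"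
  assumes W [measurable]: "W \<in> borel_measurable borel"
    and int: "(\<integral>\<^sup>+v. W v \<partial>lborel) < \<infinity>"
    and K: "countable K" and "0 < A"
    and lower: "\<And>z. A \<le> (\<integral>\<^sup>+k. W (z - pt k) \<partial>count_space K)"
    and cnt: "\<And>z. finite {k \<in> K. dist (pt k) z \<le> 1} \<and> card {k \<in> K. dist (pt k) z \<le> 1} \<le> C"
  shows "\<exists>r. \<forall>z. \<exists>k\<in>K. dist (pt k) z \<le> r"
proof -
  have shift: "(\<integral>\<^sup>+v. f (v - p) \<partial>lborel) = (\<integral>\<^sup>+v. f v \<partial>lborel)"
    if "f \<in> borel_measurable borel" for f and p :: 'a
    using nn_integral_lborel_translate[OF that, of "- p"] by simp
  \<comment> \<open>The tail of \<open>W\<close> beyond radius \<open>n\<close>; the factor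
    \<open>C\<close> accounts for the number of indices contributing at one
    \<open>v\<close>.\<close>
  define T where "T n v = of_nat C * W v * indicator {v. real n \<le> norm v} v" for n v
  have [measurable]: "T n \<in> borel_measurable borel" for n
    unfolding T_def by measurable
  have "(\<integral>\<^sup>+v. (INF n. T n v) \<partial>lborel) = (INF n. \<integral>\<^sup>+v. T n v \<partial>lborel)"
  \<comment> \<open>Convergence along a decreasing sequence requires finite integrals, supplied by
    the integrability of \<open>W\<close>.\<close>
  proof (rule nn_integral_monotone_convergence_INF_decseq)
    show "decseq T"
      by (intro decseq_SucI le_funI) (auto simp: T_def indicator_def)
    have "(\<integral>\<^sup>+v. T n v \<partial>lborel) \<le> (\<integral>\<^sup>+v. of_nat C * W v \<partial>lborel)" for n
      by (intro nn_integral_mono) (auto simp: T_def indicator_def)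
    also have "\<dots> < \<infinity>"
      using int by (simp add: nn_integral_cmult ennreal_mult_less_top of_nat_less_top)
    finally show "(\<integral>\<^sup>+v. T n v \<partial>lborel) < \<infinity>" for n .
  qed auto
  moreover have "(INF n. T n v) = 0" for v
  proof -
    obtain n where "norm v < real n" using reals_Archimedean2 by blast
    then have "T n v = 0" by (simp add: T_def)
    then show ?thesis by (metis INF_lower UNIV_I le_zero_eq)
  qed
  ultimately have tail0: "(INF n. \<integral>\<^sup>+v. T n v \<partial>lborel) = 0" by simp
  let ?a = "A * emeasure lborel (cball (0::'a) 1)"
  have vol: "0 < emeasure lborel (cball (0::'a) 1)"
    by (simp add: emeasure_cball unit_ball_vol_pos)
  then have "0 < ?a" using \<open>0 < A\<close> by (simp add: ennreal_zero_less_mult_iff)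
  then obtain n where n: "(\<integral>\<^sup>+v. T n v \<partial>lborel) < ?a"
    using tail0 by (metis INF_less_iff)
  have "\<exists>k\<in>K. dist (pt k) z \<le> real n + 1" for z
  proof (rule ccontr)
    assume no: "\<not> ?thesis"
    let ?I = "\<lambda>v. indicator (cball z 1) v :: ennreal"
    have [measurable]: "cball z 1 \<in> sets borel" by simp
    have "?a = (\<integral>\<^sup>+v. A * ?I v \<partial>lborel)"
      by (subst nn_integral_cmult_indicator) (auto simp: emeasure_cball)
    also have "\<dots> \<le> (\<integral>\<^sup>+v. (\<integral>\<^sup>+k. W (v - pt k) \<partial>count_space K) * ?I v \<partial>lborel)"
      by (intro nn_integral_mono mult_right_mono lower) auto
    also have "\<dots> = (\<integral>\<^sup>+v. (\<integral>\<^sup>+k. W (v - pt k) * ?I v \<partial>count_space K) \<partial>lborel)"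
      by (simp add: nn_integral_multc)
    also have "\<dots> = (\<integral>\<^sup>+k. \<integral>\<^sup>+v. W (v - pt k) * ?I v \<partial>lborel \<partial>count_space K)"
      using K by (subst nn_integral_count_space_nn_integral) auto
    \<comment> \<open>The substitution removes \<open>k\<close> from the argument of
      \<open>W\<close>, so that after the next exchange the inner sum only counts indices.\<close>
    also have "\<dots> = (\<integral>\<^sup>+k. \<integral>\<^sup>+v. W v * ?I (v + pt k) \<partial>lborel \<partial>count_space K)"
      using shift[of "\<lambda>v. W v * ?I (v + pt k)" "pt k" for k] by simp
    also have "\<dots> = (\<integral>\<^sup>+v. \<integral>\<^sup>+k. W v * ?I (v + pt k) \<partial>count_space K \<partial>lborel)"
      using K by (subst nn_integral_count_space_nn_integral) auto
    also have "\<dots> \<le> (\<integral>\<^sup>+v. T n v \<partial>lborel)"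
    proof (intro nn_integral_mono)
      fix v
      let ?F = "{k \<in> K. dist (pt k) (z - v) \<le> 1}"
      have mem: "v + pt k \<in> cball z 1 \<longleftrightarrow> dist (pt k) (z - v) \<le> 1" for k
        by (simp add: dist_norm norm_minus_commute algebra_simps)
      have "(\<integral>\<^sup>+k. W v * ?I (v + pt k) \<partial>count_space K) = (\<Sum>k\<in>?F. W v * ?I (v + pt k))"
        using cnt mem by (intro nn_integral_count_space') (auto simp: indicator_def)
      also have "\<dots> = of_nat (card ?F) * W v" by (simp add: indicator_def mem[simplified])
      also have "\<dots> \<le> T n v"
      proof (cases "?F = {}")
        case False
        then obtain k where k: "k \<in> K" "dist (pt k) (z - v) \<le> 1" by auto
        then have "real n + 1 < dist (pt k) z" using no by auto
        also have "\<dots> \<le> dist (pt k) (z - v) + norm v"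
          using dist_triangle[of "pt k" z "z - v"] by (simp add: dist_norm)
        finally have "real n \<le> norm v" using k by simp
        then have "T n v = of_nat C * W v" by (simp add: T_def)
        then show ?thesis using cnt by (auto intro!: mult_right_mono)
      qed (metis card.empty of_nat_0 mult_zero_left zero_le)
      finally show "(\<integral>\<^sup>+k. W v * ?I (v + pt k) \<partial>count_space K) \<le> T n v" .
    qed
    finally show False using n by simp
  qed
  then show ?thesis by blast
qed

section \<open>Bessel's inequality and the integral of the short-time Fourier transform\<close>

text \<open>Carries bounds for finite sums, such as Bessel's inequality, over to countable index
  sets by enumeration.\<close>

lemma nn_integral_count_space_le_if_finite_sums_le:
  fixes f :: "'a \<Rightarrow> ennreal"
  assumes "countable I" and le: "\<And>F. finite F \<Longrightarrow> F \<subseteq> I \<Longrightarrow> sum f F \<le> b"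
  shows "(\<integral>\<^sup>+i. f i \<partial>count_space I) \<le> b"
proof (cases "finite I")
  case True
  then show ?thesis using le by (simp add: nn_integral_count_space_finite)
next
  case False
  have bij: "bij_betw (from_nat_into I) UNIV I"
    using assms(1) False by (rule bij_betw_from_nat_into)
  have "(\<integral>\<^sup>+i. f i \<partial>count_space I) = (\<Sum>n. f (from_nat_into I n))"
    by (simp add: nn_integral_bij_count_space[OF bij, symmetric] nn_integral_count_space_nat)
  also have "\<dots> \<le> b"
  proof (rule suminf_le_const)
    fix n
    have "inj_on (from_nat_into I) {..<n}"
      using bij by (meson bij_betw_imp_inj_on inj_on_subset subset_UNIV)
    then have "(\<Sum>i<n. f (from_nat_into I i)) = sum f (from_nat_into I ` {..<n})"
      by (simp add: sum.reindex)
    also have "\<dots> \<le> b" using bij by (intro le) (auto simp: bij_betw_def)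
    finally show "(\<Sum>i<n. f (from_nat_into I i)) \<le> b" .
  qed auto
  finally show ?thesis .
qed

text \<open>Translates the real \<open>infsum\<close> of the frame inequality into the nonnegative
  integrals used for exchanging sums and integrals.\<close>

lemma ennreal_infsum_eq_nn_integral_count_space:
  fixes f :: "'a \<Rightarrow> real"
  assumes "countable I" "f summable_on I" and nonneg: "\<And>i. i \<in> I \<Longrightarrow> 0 \<le> f i"
  shows "ennreal (\<Sum>\<^sub>\<infinity>i\<in>I. f i) = (\<integral>\<^sup>+i. ennreal (f i) \<partial>count_space I)"
proof (rule antisym)
  have sums: "(\<Sum>i\<in>F. ennreal (f i)) = ennreal (sum f F)" if "F \<subseteq> I" for F
    using that nonneg by (intro sum_ennreal) auto
  show "ennreal (\<Sum>\<^sub>\<infinity>i\<in>I. f i) \<le> (\<integral>\<^sup>+i. ennreal (f i) \<partial>count_space I)"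
    using sum_le_nn_integral_count_space[of _ I "\<lambda>i. ennreal (f i)"]
    by (subst infsum_nonneg_is_SUPREMUM_ennreal[OF assms(2)])
      (auto simp: sums[symmetric] nonneg intro!: SUP_least)
  show "(\<integral>\<^sup>+i. ennreal (f i) \<partial>count_space I) \<le> ennreal (\<Sum>\<^sub>\<infinity>i\<in>I. f i)"
    using assms(1)
  proof (rule nn_integral_count_space_le_if_finite_sums_le)
    fix F assume "finite F" "F \<subseteq> I"
    then show "(\<Sum>i\<in>F. ennreal (f i)) \<le> ennreal (\<Sum>\<^sub>\<infinity>i\<in>I. f i)"
      unfolding sums[OF \<open>F \<subseteq> I\<close>]
      by (intro ennreal_leI finite_sum_le_infsum assms) (auto intro: nonneg)
  qed
qed

lemma borel_measurable_cnj [measurable]: "cnj \<in> borel_measurable borel"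
  by (intro borel_measurable_continuous_onI continuous_intros)

lemma borel_measurable_cis [measurable]: "cis \<in> borel_measurable borel"
  by (intro borel_measurable_continuous_onI continuous_intros)

lemma integrable_mult_cnj_L2:
  fixes a b :: "'a \<Rightarrow> complex"
  assumes [measurable]: "a \<in> borel_measurable M" "b \<in> borel_measurable M"
    and "integrable M (\<lambda>x. (cmod (a x))\<^sup>2)" "integrable M (\<lambda>x. (cmod (b x))\<^sup>2)"
  shows "integrable M (\<lambda>x. a x * cnj (b x))"
proof (rule Bochner_Integration.integrable_bound)
  show "integrable M (\<lambda>x. (cmod (a x))\<^sup>2 + (cmod (b x))\<^sup>2)" using assms by simp
  have "s * t \<le> s\<^sup>2 + t\<^sup>2" if "0 \<le> s" "0 \<le> t" for s t :: real
    using that sum_squares_bound[of s t] mult_nonneg_nonneg[OF that] by linarith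
  then show "AE x in M. norm (a x * cnj (b x)) \<le> norm ((cmod (a x))\<^sup>2 + (cmod (b x))\<^sup>2)"
    by (auto simp: norm_mult)
qed measurable

text \<open>The squared distance from \<open>h\<close> to its orthogonal projection \<open>S\<close>
  onto the span of the \<open>e p\<close> with \<open>p \<in> F\<close> is nonnegative; expanding it
  gives the claim.\<close>

lemma Bessel_inequality_L2:
  fixes h :: "'a \<Rightarrow> complex" and e :: "'p \<Rightarrow> 'a \<Rightarrow> complex"
  assumes h [measurable]: "h \<in> borel_measurable M" and h2: "integrable M (\<lambda>x. (cmod (h x))\<^sup>2)"
    and e [measurable]: "\<And>p. e p \<in> borel_measurable M"
    and e2: "\<And>p. integrable M (\<lambda>x. (cmod (e p x))\<^sup>2)"
    and ortho: "\<And>p q. (LINT x|M. e p x * cnj (e q x)) = of_bool (p = q)"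
    and "finite F"
  shows "(\<Sum>p\<in>F. (cmod (LINT x|M. e p x * cnj (h x)))\<^sup>2) \<le> (LINT x|M. (cmod (h x))\<^sup>2)"
proof -
  \<comment> \<open>This is the conjugate of the usual coefficient of \<open>h\<close>, hence the
    \<open>cnj\<close> in the projection \<open>S\<close>.\<close>
  define c where "c p = (LINT x|M. e p x * cnj (h x))" for p
  define S where "S x = (\<Sum>p\<in>F. cnj (c p) * e p x)" for x
  have eh: "integrable M (\<lambda>x. e p x * cnj (h x))" for p
    by (intro integrable_mult_cnj_L2 e e2 h h2)
  have he: "integrable M (\<lambda>x. h x * cnj (e p x))" for p
    by (intro integrable_mult_cnj_L2 e e2 h h2)
  have ee: "integrable M (\<lambda>x. e p x * cnj (e q x))" for p q
    by (intro integrable_mult_cnj_L2 e e2)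
  have hh: "integrable M (\<lambda>x. h x * cnj (h x))"
    by (intro integrable_mult_cnj_L2 h h2)
  have he_c: "(LINT x|M. h x * cnj (e p x)) = cnj (c p)" for p
  proof -
    have "(LINT x|M. h x * cnj (e p x)) = (LINT x|M. cnj (e p x * cnj (h x)))"
      by (simp add: mult.commute)
    then show ?thesis by (simp add: c_def del: complex_cnj_mult)
  qed
  let ?C = "\<Sum>p\<in>F. cnj (c p) * c p"
  have Sh: "S x * cnj (h x) = (\<Sum>p\<in>F. cnj (c p) * (e p x * cnj (h x)))" for x
    by (simp add: S_def sum_distrib_right mult.assoc)
  have hS: "h x * cnj (S x) = (\<Sum>p\<in>F. c p * (h x * cnj (e p x)))" for x
    by (simp add: S_def sum_distrib_left mult_ac)
  have SS: "S x * cnj (S x) = (\<Sum>p\<in>F. \<Sum>q\<in>F. cnj (c p) * c q * (e p x * cnj (e q x)))" for x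
    unfolding S_def cnj_sum sum_product by (simp add: mult_ac)
  \<comment> \<open>The two cross terms and the square of \<open>S\<close> all integrate to
    \<open>?C\<close>, so the expansion leaves the squared norm of \<open>h\<close> minus a single
    \<open>?C\<close>.\<close>
  have int_Sh: "integrable M (\<lambda>x. S x * cnj (h x))" "(LINT x|M. S x * cnj (h x)) = ?C"
    unfolding Sh using eh by (auto simp: c_def)
  have int_hS: "integrable M (\<lambda>x. h x * cnj (S x))" "(LINT x|M. h x * cnj (S x)) = ?C"
    unfolding hS using he by (auto simp: he_c mult.commute)
  have int_SS: "integrable M (\<lambda>x. S x * cnj (S x))" "(LINT x|M. S x * cnj (S x)) = ?C"
    unfolding SS using ee \<open>finite F\<close> by (auto simp: ortho if_distrib sum.delta cong: if_cong)
  have "complex_of_real (LINT x|M. (cmod (h x - S x))\<^sup>2) =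
      (LINT x|M. (h x * cnj (h x) - S x * cnj (h x)) - (h x * cnj (S x) - S x * cnj (S x)))"
    unfolding integral_complex_of_real[symmetric] complex_norm_square
    by (simp add: algebra_simps)
  also have "\<dots> = (LINT x|M. h x * cnj (h x)) - ?C"
    using int_Sh int_hS int_SS hh by (simp add: Bochner_Integration.integral_diff)
  also have "\<dots> = complex_of_real ((LINT x|M. (cmod (h x))\<^sup>2) - (\<Sum>p\<in>F. (cmod (c p))\<^sup>2))"
    by (simp add: complex_norm_square[symmetric] mult.commute integral_complex_of_real[symmetric])
  finally have "(LINT x|M. (cmod (h x - S x))\<^sup>2) = (LINT x|M. (cmod (h x))\<^sup>2) - (\<Sum>p\<in>F. (cmod (c p))\<^sup>2)"
    by (simp only: of_real_eq_iff)
  moreover have "0 \<le> (LINT x|M. (cmod (h x - S x))\<^sup>2)" by simp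
  ultimately show ?thesis by (simp add: c_def)
qed

section \<open>Characters on the unit cube\<close>

text \<open>\<open>lborel\<close> is the image of a product of one-dimensional Lebesgue measures
  under the coordinate map, so Fubini for finite products applies.\<close>

lemma integral_prod_Basis:
  fixes F :: "'a::euclidean_space \<Rightarrow> real \<Rightarrow> complex"
  assumes "\<And>b. b \<in> Basis \<Longrightarrow> integrable lborel (F b)"
  shows "(LINT x|(lborel::'a measure). (\<Prod>b\<in>Basis. F b (x \<bullet> b))) = (\<Prod>b\<in>Basis. (LINT s|lborel. F b s))"
proof -
  interpret product_sigma_finite "\<lambda>_::'a. lborel :: real measure" ..
  have [measurable]: "F b \<in> borel_measurable borel" if "b \<in> Basis" for b
    using assms[OF that] by auto
  have inner: "(\<Sum>b'\<in>Basis. f b' *\<^sub>R b') \<bullet> b = f b" if "b \<in> Basis" for f and b :: 'a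
    using that by (simp add: inner_sum_left inner_Basis if_distrib cong: if_cong)
  have "(LINT x|(lborel::'a measure). (\<Prod>b\<in>Basis. F b (x \<bullet> b))) =
     (LINT f|(\<Pi>\<^sub>M b\<in>(Basis::'a set). lborel). (\<Prod>b\<in>Basis. F b ((\<Sum>b'\<in>Basis. f b' *\<^sub>R b') \<bullet> b)))"
    unfolding lborel_eq[where 'a='a] by (subst integral_distr) measurable
  also have "\<dots> = (LINT f|(\<Pi>\<^sub>M b\<in>(Basis::'a set). lborel). (\<Prod>b\<in>Basis. F b (f b)))"
    by (intro Bochner_Integration.integral_cong prod.cong refl) (simp add: inner)
  also have "\<dots> = (\<Prod>b\<in>Basis. (LINT s|lborel. F b s))"
    by (rule product_integral_prod) (auto intro: assms)
  finally show ?thesis .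
qed

lemma integral_cis_unit_interval:
  assumes "k \<in> \<int>"
  shows "integrable lborel (\<lambda>s. of_bool (0 \<le> s \<and> s < 1) * cis (2 * pi * (k * s)))" (is ?int)
    and "(LINT s|lborel. of_bool (0 \<le> s \<and> s < 1) * cis (2 * pi * (k * s))) = of_bool (k = 0)" (is ?eq)
proof -
  let ?f = "\<lambda>s. cis (2 * pi * (k * s))"
  \<comment> \<open>An antiderivative on the real line; frequency 0 needs its own branch to avoid
    dividing by zero.\<close>
  let ?F = "\<lambda>s. if k = 0 then of_real s else cis (2 * pi * (k * s)) / (2 * pi * k * \<i>)"
  have deriv: "(?F has_vector_derivative ?f s) (at s within {0..1})" for s
  proof (cases "k = 0")
    case True
    then show ?thesis by (auto intro!: derivative_eq_intros simp: has_vector_derivative_of_real)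
  next
    case False
    let ?c = "2 * complex_of_real pi * complex_of_real k * \<i>"
    have "((\<lambda>z. exp (?c * z) / ?c) has_field_derivative exp (?c * of_real s)) (at (of_real s))"
      using False by (auto intro!: derivative_eq_intros)
    then have "((\<lambda>s. exp (?c * of_real s) / ?c) has_vector_derivative exp (?c * of_real s)) (at s within {0..1})"
      by (rule has_vector_derivative_real_field)
    then show ?thesis using False by (simp add: cis_conv_exp mult_ac)
  qed
  have cont: "continuous_on {0..1} ?f" by (intro continuous_intros)
  have bi: "has_bochner_integral lborel (\<lambda>s. indicator {0..1} s *\<^sub>R ?f s) (?F 1 - ?F 0)"
    by (rule has_bochner_integral_FTC_Icc[OF _ deriv cont]) simp
  have val: "?F 1 - ?F 0 = of_bool (k = 0)"
  proof -
    obtain n :: int where "k = n" using assms by (auto elim: Ints_cases)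
    then have "cis (2 * pi * k) = 1" by (simp add: cis_multiple_2pi)
    then show ?thesis by simp
  qed
  have [measurable]: "?f \<in> borel_measurable borel"
    by (intro borel_measurable_continuous_onI continuous_intros)
  \<comment> \<open>The fundamental theorem concerns the closed interval; the half-open one differs
    from it only by the null set {1}.\<close>
  have ae: "AE s in lborel. indicator {0..1} s *\<^sub>R ?f s = of_bool (0 \<le> s \<and> s < 1) * ?f s"
    using AE_lborel_singleton[of 1] by eventually_elim (auto simp: indicator_def)
  have "has_bochner_integral lborel (\<lambda>s. of_bool (0 \<le> s \<and> s < 1) * ?f s) (of_bool (k = 0))"
    using bi unfolding val by (subst (asm) has_bochner_integral_cong_AE[OF _ _ ae]) measurable
  then show ?int ?eq by (auto simp: has_bochner_integral_iff)
qed

section \<open>Time-frequency shifts of the cube indicator\<close>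

text \<open>Half-open, so that integer translates are pairwise disjoint and still cover the
  space.\<close>

definition unit_cube :: "(real^'m) set" where
  "unit_cube = {x. \<forall>i. 0 \<le> x $ i \<and> x $ i < 1}"

definition pulse :: "real^'m \<Rightarrow> complex" where
  "pulse = indicator unit_cube"

definition int_vec :: "('m \<Rightarrow> int) \<Rightarrow> real^'m" where
  "int_vec a = (\<chi> i. of_int (a i))"

definition int_point :: "('m \<Rightarrow> int) \<times> ('m \<Rightarrow> int) \<Rightarrow> (real^'m) \<times> (real^'m)" where
  "int_point p = (int_vec (fst p), int_vec (snd p))"

text \<open>The conjugate of the short-time Fourier transform of \<open>h\<close> with window
  \<open>pulse\<close>; it is the function V of the outline, with a Borel function \<open>h\<close>
  in place of \<open>g\<close>.\<close>

definition stft :: "(real^'m \<Rightarrow> complex) \<Rightarrow> (real^'m) \<times> (real^'m) \<Rightarrow> complex" where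
  "stft h u = (LINT x|lborel. tf_shift 0 u pulse x * cnj (h x))"

lemma unit_cube_borel [measurable]: "(unit_cube :: (real^'m) set) \<in> sets borel"
  unfolding unit_cube_def by measurable

lemma pulse_measurable [measurable]: "(pulse :: real^'m \<Rightarrow> complex) \<in> borel_measurable borel"
  unfolding pulse_def by measurable

lemma cis_inner_measurable [measurable]:
  fixes w :: "'a::euclidean_space"
  shows "(\<lambda>x. cis (2 * pi * (w \<bullet> x))) \<in> borel_measurable borel"
  by (intro borel_measurable_continuous_onI continuous_intros)

lemma tf_shift_measurable [measurable]:
  assumes [measurable]: "h \<in> borel_measurable borel"
  shows "tf_shift \<phi> u h \<in> borel_measurable borel"
  unfolding tf_shift_def by measurable

lemma int_vec_diff: "int_vec a - int_vec b = int_vec (\<lambda>i. a i - b i)"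
  by (simp add: int_vec_def vec_eq_iff)

lemma pulse_shift_mult_eq_0:
  assumes "a \<noteq> b"
  shows "pulse (y - int_vec a) * pulse (y - int_vec b) = 0"
proof (rule ccontr)
  assume "\<not> ?thesis"
  then have *: "0 \<le> y $ i - a i" "y $ i - a i < 1" "0 \<le> y $ i - b i" "y $ i - b i < 1" for i
    by (auto simp: pulse_def unit_cube_def int_vec_def split: split_indicator_asm)
  have "a i = b i" for i using *[of i] by linarith
  with assms show False by blast
qed

lemma integral_translate_lborel:
  fixes f :: "'a::euclidean_space \<Rightarrow> complex"
  assumes [measurable]: "f \<in> borel_measurable borel"
  shows "(LINT x|lborel. f (t + x)) = (LINT x|lborel. f x)"
proof -
  have "(LINT x|lborel. f x) = (LINT x|distr lborel borel ((+) t). f x)"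
    by (simp add: lborel_distr_plus)
  also have "\<dots> = (LINT x|lborel. f (t + x))" by (subst integral_distr) auto
  finally show ?thesis ..
qed

text \<open>The integrand factors over the coordinates, and each factor is the integral of a
  one-dimensional character of integer frequency.\<close>

lemma integral_character_pulse:
  fixes a :: "'m::finite \<Rightarrow> int"
  shows "(LINT x|lborel. cis (2 * pi * (int_vec a \<bullet> x)) * pulse x) = of_bool (a = (\<lambda>_. 0))"
proof -
  let ?k = "int_vec a :: real^'m"
  let ?F = "\<lambda>b s. of_bool (0 \<le> s \<and> s < 1) * cis (2 * pi * ((?k \<bullet> b) * s))"
  have Ints: "?k \<bullet> b \<in> \<int>" if "b \<in> Basis" for b
    using that by (auto simp: Basis_vec_def int_vec_def inner_axis)
  have prod_cis: "(\<Prod>b\<in>B. cis (f b)) = cis (sum f B)" if "finite B" for B and f :: "real^'m \<Rightarrow> real"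
    using that by induction (auto simp: cis_mult)
  have ind: "(\<Prod>b\<in>Basis. of_bool (0 \<le> x \<bullet> b \<and> x \<bullet> b < 1)) = pulse x" for x :: "real^'m"
  proof -
    have "(\<Prod>b\<in>Basis. of_bool (0 \<le> x \<bullet> b \<and> x \<bullet> b < 1)) = (of_bool (\<forall>b\<in>Basis. 0 \<le> x \<bullet> b \<and> x \<bullet> b < 1) :: complex)"
      by (auto intro!: prod.neutral)
    also have "\<dots> = pulse x"
      by (auto simp: pulse_def unit_cube_def indicator_def Basis_vec_def inner_axis)
    finally show ?thesis .
  qed
  have "(\<Prod>b\<in>Basis. ?F b (x \<bullet> b)) = cis (2 * pi * (?k \<bullet> x)) * pulse x" for x
    by (simp add: prod.distrib ind prod_cis sum_distrib_left[symmetric] euclidean_inner[of ?k x] mult.commute)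
  then have "(LINT x|lborel. cis (2 * pi * (?k \<bullet> x)) * pulse x) = (LINT x|(lborel::(real^'m) measure). (\<Prod>b\<in>Basis. ?F b (x \<bullet> b)))"
    by simp
  also have "\<dots> = (\<Prod>b\<in>Basis. (LINT s|lborel. ?F b s))"
    by (rule integral_prod_Basis) (rule integral_cis_unit_interval Ints)+
  also have "\<dots> = (\<Prod>b\<in>Basis. of_bool (?k \<bullet> b = 0))"
    by (intro prod.cong refl integral_cis_unit_interval Ints)
  also have "\<dots> = of_bool (\<forall>b\<in>Basis. ?k \<bullet> b = 0)"
    by (auto intro!: prod.neutral)
  also have "(\<forall>b\<in>Basis. ?k \<bullet> b = 0) \<longleftrightarrow> a = (\<lambda>_. 0)"
    by (auto simp: Basis_vec_def int_vec_def inner_axis fun_eq_iff)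
  finally show ?thesis .
qed

text \<open>Distinct integer translations have disjoint supports; for equal translations the product
  is an integer character on a translated cube. The offset \<open>u\<close> is arbitrary because
  Bessel's inequality is applied at every point of a unit cell.\<close>

lemma tf_shift_pulse_orthonormal:
  fixes u :: "(real^'m) \<times> (real^'m)"
  shows "(LINT x|lborel. tf_shift 0 (int_point p + u) pulse x * cnj (tf_shift 0 (int_point q + u) pulse x))
     = of_bool (p = q)"
proof (cases "fst p = fst q")
  case False
  have "pulse (x - fst (int_point p + u)) * cnj (pulse (x - fst (int_point q + u))) = 0" for x
    using pulse_shift_mult_eq_0[OF False, of "x - fst u"]
    by (auto simp: int_point_def algebra_simps)
  then have "tf_shift 0 (int_point p + u) pulse x * cnj (tf_shift 0 (int_point q + u) pulse x) = 0" for x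
    by (auto simp: tf_shift_def)
  with False show ?thesis by (simp only:) auto
next
  case True
  define a where "a = (\<lambda>i. snd p i - snd q i)"
  let ?t = "fst (int_point p + u)"
  have eq: "tf_shift 0 (int_point p + u) pulse x * cnj (tf_shift 0 (int_point q + u) pulse x) =
      cis (2 * pi * (int_vec a \<bullet> x)) * pulse (x - ?t)" for x
  proof -
    have "fst (int_point q + u) = ?t" using True by (simp add: int_point_def)
    moreover have "pulse y * cnj (pulse y) = pulse y" for y :: "real^'m"
      by (simp add: pulse_def indicator_def)
    moreover have "cis (2 * pi * (snd (int_point p + u) \<bullet> x)) * cnj (cis (2 * pi * (snd (int_point q + u) \<bullet> x)))
        = cis (2 * pi * (int_vec a \<bullet> x))"
      by (simp add: cis_cnj cis_mult int_point_def a_def int_vec_diff[symmetric] inner_diff_left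
          inner_add_left algebra_simps)
    moreover have "tf_shift 0 (int_point p + u) pulse x * cnj (tf_shift 0 (int_point q + u) pulse x) =
        (cis (2 * pi * (snd (int_point p + u) \<bullet> x)) * cnj (cis (2 * pi * (snd (int_point q + u) \<bullet> x)))) *
        (pulse (x - ?t) * cnj (pulse (x - fst (int_point q + u))))"
      unfolding tf_shift_def cis_zero mult_1_left complex_cnj_mult by (simp only: mult_ac)
    ultimately show ?thesis by (simp only:)
  qed
  \<comment> \<open>Moving the cube back to the origin produces a unimodular factor, which is 1 in
    the only case where the integral does not vanish.\<close>
  have "(LINT x|lborel. cis (2 * pi * (int_vec a \<bullet> x)) * pulse (x - ?t))
      = (LINT x|lborel. cis (2 * pi * (int_vec a \<bullet> (?t + x))) * pulse (?t + x - ?t))"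
    by (rule integral_translate_lborel[symmetric]) measurable
  also have "\<dots> = (LINT x|lborel. cis (2 * pi * (int_vec a \<bullet> ?t)) * (cis (2 * pi * (int_vec a \<bullet> x)) * pulse x))"
    by (simp add: inner_add_right distrib_left cis_mult[symmetric] mult.assoc)
  also have "\<dots> = cis (2 * pi * (int_vec a \<bullet> ?t)) * of_bool (a = (\<lambda>_. 0))"
    by (simp add: integral_character_pulse)
  also have "\<dots> = of_bool (p = q)"
  proof (cases "a = (\<lambda>_. 0)")
    case a0: True
    then have "p = q" using True by (auto simp: a_def prod_eq_iff fun_eq_iff)
    then show ?thesis using a0 by (simp add: int_vec_def zero_vec_def[symmetric])
  next
    case False
    then have "p \<noteq> q" by (auto simp: a_def)
    then show ?thesis using False by simp
  qed
  finally show ?thesis by (simp add: eq)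
qed

lemma integrable_tf_shift_pulse:
  fixes u :: "(real^'m) \<times> (real^'m)"
  shows "integrable lborel (\<lambda>x. (cmod (tf_shift \<phi> u pulse x))\<^sup>2)"
proof -
  have eq: "(cmod (tf_shift \<phi> u pulse x))\<^sup>2 = indicator ((+) (fst u) ` unit_cube) x" for x
  proof -
    have "x - fst u \<in> unit_cube \<longleftrightarrow> x \<in> (+) (fst u) ` unit_cube"
      by (force simp: image_iff)
    then show ?thesis by (auto simp: tf_shift_def norm_mult pulse_def indicator_def)
  qed
  have "bounded (unit_cube :: (real^'m) set)"
    by (rule bounded_subset[OF bounded_cbox[of 0 1]]) (auto simp: unit_cube_def mem_box_cart less_imp_le)
  then have "emeasure lborel ((+) (fst u) ` unit_cube) < \<infinity>"
    by (intro emeasure_bounded_finite bounded_translation)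
  moreover have "(+) (fst u) ` unit_cube \<in> sets borel"
  proof -
    have "(+) (fst u) ` unit_cube = (\<lambda>x. x - fst u) -` unit_cube \<inter> space borel"
      by (force simp: image_iff)
    also have "\<dots> \<in> sets borel" by measurable
    finally show ?thesis .
  qed
  ultimately show ?thesis unfolding eq by (simp add: integrable_indicator_iff)
qed

lemma L2_tf_shift_pulse:
  fixes u :: "(real^'m) \<times> (real^'m)"
  shows "L2 (tf_shift 0 u pulse)" "L2_normsq (tf_shift 0 u pulse) = 1"
proof -
  have [measurable]: "tf_shift 0 u pulse \<in> borel_measurable lebesgue"
    by (rule measurable_completion) measurable
  show "L2 (tf_shift 0 u pulse)"
    unfolding L2_def using integrable_tf_shift_pulse[of 0 u] by (auto simp: integrable_completion)
  \<comment> \<open>The norm is the diagonal case of orthonormality, taken at the integer point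
    0.\<close>
  have "complex_of_real (LINT x|lborel. (cmod (tf_shift 0 u pulse x))\<^sup>2) = 1"
    using tf_shift_pulse_orthonormal[of "(\<lambda>_. 0, \<lambda>_. 0)" u "(\<lambda>_. 0, \<lambda>_. 0)"]
    unfolding integral_complex_of_real[symmetric] complex_norm_square
    by (simp add: int_point_def int_vec_def zero_vec_def[symmetric] zero_prod_def[symmetric])
  then show "L2_normsq (tf_shift 0 u pulse) = 1"
    unfolding L2_normsq_def by (subst integral_completion) auto
qed

lemma tf_shift_measurable_pair:
  "(\<lambda>(u :: (real^'m) \<times> (real^'m), x). tf_shift 0 u pulse x) \<in> borel_measurable (borel \<Otimes>\<^sub>M borel)"
proof -
  have [measurable]: "(fst :: (real^'m) \<times> (real^'m) \<Rightarrow> _) \<in> borel \<rightarrow>\<^sub>M borel"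
      "(snd :: (real^'m) \<times> (real^'m) \<Rightarrow> _) \<in> borel \<rightarrow>\<^sub>M borel"
    by (intro borel_measurable_continuous_onI continuous_intros)+
  show ?thesis
    unfolding tf_shift_def split_beta by measurable
qed

lemma stft_measurable [measurable]:
  fixes h :: "real^'m \<Rightarrow> complex"
  assumes [measurable]: "h \<in> borel_measurable borel"
  shows "stft h \<in> borel_measurable borel"
proof -
  have "(\<lambda>(u, x). tf_shift 0 u pulse x * cnj (h x)) \<in> borel_measurable (borel \<Otimes>\<^sub>M lborel)"
    using tf_shift_measurable_pair by measurable
  then show ?thesis unfolding stft_def[abs_def]
    by (rule lborel.borel_measurable_lebesgue_integral)
qed

text \<open>The time-frequency plane is cut into integer translates of the cell \<open>U\<close> and
  every piece is moved back to \<open>U\<close>. For each offset \<open>u\<close> in the cell the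
  resulting sum is bounded by Bessel's inequality, so the integral is at most the squared norm of
  \<open>h\<close> times the volume of \<open>U\<close>.\<close>

lemma nn_integral_stft_finite:
  fixes h :: "real^'m \<Rightarrow> complex"
  assumes [measurable]: "h \<in> borel_measurable borel" and h2: "integrable lborel (\<lambda>x. (cmod (h x))\<^sup>2)"
  shows "(\<integral>\<^sup>+u. ennreal ((cmod (stft h u))\<^sup>2) \<partial>lborel) < \<infinity>"
proof -
  let ?W = "\<lambda>u. ennreal ((cmod (stft h u))\<^sup>2)"
  let ?n = "ennreal (LINT x|lborel. (cmod (h x))\<^sup>2)"
  define U :: "((real^'m) \<times> (real^'m)) set" where "U = unit_cube \<times> unit_cube"
  have [measurable]: "U \<in> sets borel"
    unfolding U_def borel_prod[symmetric] by measurable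
  have "U \<subseteq> cbox 0 (1, 1)"
    by (auto simp: U_def zero_prod_def unit_cube_def mem_box_cart less_imp_le cbox_Pair_eq)
  then have "bounded U" using bounded_cbox bounded_subset by blast
  then have fin: "emeasure lborel U < \<infinity>" by (rule emeasure_bounded_finite)
  have cover: "\<exists>p. v - int_point p \<in> U" for v
  proof
    let ?p = "(\<lambda>i. \<lfloor>fst v $ i\<rfloor>, \<lambda>i. \<lfloor>snd v $ i\<rfloor>)"
    show "v - int_point ?p \<in> U"
      by (auto simp: U_def mem_Times_iff unit_cube_def int_point_def int_vec_def)
        (linarith)+
  qed
  have "(\<integral>\<^sup>+v. ?W v \<partial>lborel) \<le> (\<integral>\<^sup>+v. \<integral>\<^sup>+p. ?W v * indicator U (v - int_point p) \<partial>count_space UNIV \<partial>lborel)"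
  proof (intro nn_integral_mono)
    fix v
    obtain p where "v - int_point p \<in> U" using cover by blast
    \<comment> \<open>One cell containing \<open>v\<close> is enough, since only an upper bound is
      needed.\<close>
    then have "?W v = (\<Sum>p\<in>{p}. ?W v * indicator U (v - int_point p))" by simp
    also have "\<dots> \<le> (\<integral>\<^sup>+p. ?W v * indicator U (v - int_point p) \<partial>count_space UNIV)"
      by (rule sum_le_nn_integral_count_space) auto
    finally show "?W v \<le> (\<integral>\<^sup>+p. ?W v * indicator U (v - int_point p) \<partial>count_space UNIV)" .
  qed
  also have "\<dots> = (\<integral>\<^sup>+p. \<integral>\<^sup>+v. ?W v * indicator U (v - int_point p) \<partial>lborel \<partial>count_space UNIV)"
    by (rule nn_integral_count_space_nn_integral) auto
  also have "\<dots> = (\<integral>\<^sup>+p. \<integral>\<^sup>+u. ?W (int_point p + u) * indicator U u \<partial>lborel \<partial>count_space UNIV)"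
  proof (rule nn_integral_cong)
    fix p
    show "(\<integral>\<^sup>+v. ?W v * indicator U (v - int_point p) \<partial>lborel) = (\<integral>\<^sup>+u. ?W (int_point p + u) * indicator U u \<partial>lborel)"
      by (subst nn_integral_lborel_translate[symmetric, where a = "int_point p"]) auto
  qed
  also have "\<dots> = (\<integral>\<^sup>+u. \<integral>\<^sup>+p. ?W (int_point p + u) * indicator U u \<partial>count_space UNIV \<partial>lborel)"
    by (rule nn_integral_count_space_nn_integral[symmetric]) auto
  also have "\<dots> \<le> (\<integral>\<^sup>+u. ?n * indicator U u \<partial>lborel)"
  proof (intro nn_integral_mono)
    fix u
    have "(\<integral>\<^sup>+p. ?W (int_point p + u) \<partial>count_space UNIV) \<le> ?n"
    proof (rule nn_integral_count_space_le_if_finite_sums_le)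
      fix F :: "(('m \<Rightarrow> int) \<times> ('m \<Rightarrow> int)) set" assume "finite F"
      then have "(\<Sum>p\<in>F. (cmod (stft h (int_point p + u)))\<^sup>2) \<le> (LINT x|lborel. (cmod (h x))\<^sup>2)"
        unfolding stft_def
        by (intro Bessel_inequality_L2 h2 integrable_tf_shift_pulse tf_shift_pulse_orthonormal) auto
      then show "(\<Sum>p\<in>F. ?W (int_point p + u)) \<le> ?n" by (simp add: ennreal_leI)
    qed auto
    then show "(\<integral>\<^sup>+p. ?W (int_point p + u) * indicator U u \<partial>count_space UNIV) \<le> ?n * indicator U u"
      by (auto simp: indicator_def)
  qed
  also have "\<dots> = ?n * emeasure lborel U" by (rule nn_integral_cmult_indicator) auto
  also have "\<dots> < \<infinity>" using fin by (simp add: ennreal_mult_less_top)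
  finally show ?thesis .
qed

section \<open>From the frame window to a Borel function\<close>

text \<open>The frame hypothesis speaks of Lebesgue-measurable functions, whereas translation and
  parameter integrals are handled here for Borel ones; real and imaginary parts are replaced
  separately.\<close>

lemma borel_representative:
  fixes g :: "real^'m \<Rightarrow> complex"
  assumes "g \<in> borel_measurable lebesgue"
  obtains h where "h \<in> borel_measurable borel" "AE x in lborel. g x = h x"
proof -
  have *: "(\<lambda>x. Re (g x)) \<in> borel_measurable lebesgue" "(\<lambda>x. Im (g x)) \<in> borel_measurable lebesgue"
    using assms by simp_all
  obtain a where [measurable]: "a \<in> borel_measurable lborel" and a: "AE x in lborel. Re (g x) = a x"
    using completion_ex_borel_measurable_real[OF *(1)] by blast
  obtain b where [measurable]: "b \<in> borel_measurable lborel" and b: "AE x in lborel. Im (g x) = b x"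
    using completion_ex_borel_measurable_real[OF *(2)] by blast
  show thesis
  proof
    show "(\<lambda>x. Complex (a x) (b x)) \<in> borel_measurable borel"
      unfolding Complex_eq by measurable
    show "AE x in lborel. g x = Complex (a x) (b x)"
      using a b by eventually_elim (simp add: complex_eq_iff)
  qed
qed

text \<open>Covariance of time-frequency shifts: translating the integral by \<open>fst w\<close>
  leaves the shift by \<open>u - w\<close> up to a unimodular constant. The modulus removes this
  constant together with the phase \<open>\<phi>\<close>, hence the freedom in choosing
  phases.\<close>

lemma cmod_L2_inner_tf_shift:
  fixes g h :: "real^'m \<Rightarrow> complex"
  assumes [measurable]: "h \<in> borel_measurable borel"
    and ae: "AE x in lborel. g x = h x"
    and L2: "L2 (tf_shift \<phi> w g)"
  shows "cmod (L2_inner (tf_shift 0 u pulse) (tf_shift \<phi> w g)) = cmod (stft h (u - w))"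
proof -
  obtain N where N: "{x. g x \<noteq> h x} \<subseteq> N" "N \<in> null_sets lborel"
    using ae by (auto elim!: AE_E simp: null_sets_def)
  \<comment> \<open>Translates of null sets are null, so the almost everywhere equality survives the
    shift.\<close>
  have "AE x in lborel. g (x - fst w) = h (x - fst w)"
    using null_sets_translation[OF N(2), of "fst w"] by (rule AE_I') (use N(1) in auto)
  then have ae': "AE x in lebesgue. g (x - fst w) = h (x - fst w)" by (rule AE_completion)
  have [measurable]: "tf_shift \<phi> w g \<in> borel_measurable lebesgue"
    using L2 by (simp add: L2_def)
  have [measurable]: "tf_shift 0 u pulse \<in> borel_measurable lebesgue" "tf_shift \<phi> w h \<in> borel_measurable lebesgue"
    by (rule measurable_completion; measurable)+
  have "L2_inner (tf_shift 0 u pulse) (tf_shift \<phi> w g) = L2_inner (tf_shift 0 u pulse) (tf_shift \<phi> w h)"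
    unfolding L2_inner_def
  proof (rule integral_cong_AE)
    show "AE x in lebesgue. tf_shift 0 u pulse x * cnj (tf_shift \<phi> w g x)
        = tf_shift 0 u pulse x * cnj (tf_shift \<phi> w h x)"
      using ae' by eventually_elim (simp add: tf_shift_def)
  qed measurable
  also have "\<dots> = (LINT x|lborel. tf_shift 0 u pulse x * cnj (tf_shift \<phi> w h x))"
    unfolding L2_inner_def by (rule integral_completion) measurable
  also have "\<dots> = (LINT x|lborel. tf_shift 0 u pulse (fst w + x) * cnj (tf_shift \<phi> w h (fst w + x)))"
    by (rule integral_translate_lborel[symmetric]) measurable
  also have "\<dots> = (LINT x|lborel. cis (2 * pi * ((snd u - snd w) \<bullet> fst w) - \<phi>) * (tf_shift 0 (u - w) pulse x * cnj (h x)))"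
  proof (rule Bochner_Integration.integral_cong[OF refl])
    fix x
    have "cis (2 * pi * (snd u \<bullet> (fst w + x))) * cnj (cis \<phi> * cis (2 * pi * (snd w \<bullet> (fst w + x))))
      = cis (2 * pi * ((snd u - snd w) \<bullet> fst w) - \<phi>) * cis (2 * pi * (snd (u - w) \<bullet> x))"
      by (simp add: cis_cnj cis_mult algebra_simps inner_add_right inner_diff_left)
    moreover have "fst w + x - fst u = x - fst (u - w)" by simp
    moreover have "tf_shift 0 u pulse (fst w + x) * cnj (tf_shift \<phi> w h (fst w + x)) =
        (cis (2 * pi * (snd u \<bullet> (fst w + x))) * cnj (cis \<phi> * cis (2 * pi * (snd w \<bullet> (fst w + x))))) *
        (pulse (fst w + x - fst u) * cnj (h x))"
      unfolding tf_shift_def add_diff_cancel_left' cis_zero mult_1_left complex_cnj_mult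
      by (simp only: mult_ac)
    ultimately show "tf_shift 0 u pulse (fst w + x) * cnj (tf_shift \<phi> w h (fst w + x)) =
       cis (2 * pi * ((snd u - snd w) \<bullet> fst w) - \<phi>) * (tf_shift 0 (u - w) pulse x * cnj (h x))"
      by (simp only: tf_shift_def cis_zero mult_1_left mult.assoc)
  qed
  finally show ?thesis by (simp add: stft_def norm_mult)
qed

section \<open>Gabor frames\<close>

lemma supnorm_tf_le_iff:
  "supnorm_tf p \<le> r \<longleftrightarrow> (\<forall>i. \<bar>fst p $ i\<bar> \<le> r \<and> \<bar>snd p $ i\<bar> \<le> r)"
  by (auto simp: supnorm_tf_def)

lemma component_le_supnorm_tf: "\<bar>fst p $ i\<bar> \<le> supnorm_tf p" "\<bar>snd p $ i\<bar> \<le> supnorm_tf p"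
  using supnorm_tf_le_iff[of p "supnorm_tf p"] by auto

lemma supnorm_tf_nonneg: "0 \<le> supnorm_tf p"
  using component_le_supnorm_tf(1)[of p undefined] by linarith

lemma supnorm_tf_triangle: "supnorm_tf (p + q) \<le> supnorm_tf p + supnorm_tf q"
  unfolding supnorm_tf_le_iff using component_le_supnorm_tf[of p] component_le_supnorm_tf[of q]
  by (auto intro!: order_trans[OF abs_triangle_ineq] add_mono)

lemma supnorm_tf_scaleR: "supnorm_tf (a *\<^sub>R p) = \<bar>a\<bar> * supnorm_tf p"
proof -
  have le: "supnorm_tf (b *\<^sub>R q) \<le> \<bar>b\<bar> * supnorm_tf q" for b and q :: "(real^'a) \<times> (real^'a)"
    unfolding supnorm_tf_le_iff using component_le_supnorm_tf[of q]
    by (auto simp: abs_mult intro!: mult_left_mono)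
  show ?thesis
  proof (cases "a = 0")
    case True
    then show ?thesis using le[of 0 p] supnorm_tf_nonneg[of "0 *\<^sub>R p"] by simp
  next
    case False
    then have "\<bar>a\<bar> * supnorm_tf p \<le> supnorm_tf (a *\<^sub>R p)"
      using le[of "inverse a" "a *\<^sub>R p"] by (simp add: field_simps)
    then show ?thesis using le[of a p] by simp
  qed
qed

lemma supnorm_tf_minus_commute: "supnorm_tf (p - q) = supnorm_tf (q - p)"
  using supnorm_tf_scaleR[of "-1" "p - q"] by simp

lemma supnorm_tf_le_norm: "supnorm_tf p \<le> norm p"
  unfolding supnorm_tf_le_iff
  using component_le_norm_cart[of "fst p"] component_le_norm_cart[of "snd p"]
    norm_fst_le[of "fst p" "snd p"] norm_snd_le[of "snd p" "fst p"]
  by (auto intro: order_trans)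

lemma norm_le_supnorm_tf:
  fixes p :: "(real^'m) \<times> (real^'m)"
  shows "norm p \<le> 2 * real CARD('m) * supnorm_tf p"
proof -
  have "norm (fst p) \<le> real CARD('m) * supnorm_tf p"
    using norm_le_l1_cart[of "fst p"] sum_bounded_above[of UNIV "\<lambda>i. \<bar>fst p $ i\<bar>" "supnorm_tf p"]
      component_le_supnorm_tf[of p] by force
  moreover have "norm (snd p) \<le> real CARD('m) * supnorm_tf p"
    using norm_le_l1_cart[of "snd p"] sum_bounded_above[of UNIV "\<lambda>i. \<bar>snd p $ i\<bar>" "supnorm_tf p"]
      component_le_supnorm_tf[of p] by force
  moreover have "norm p \<le> norm (fst p) + norm (snd p)"
    using norm_Pair_le[of "fst p" "snd p"] by simp
  ultimately show ?thesis by linarith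
qed

text \<open>Testing the frame inequality on the pulse shifted by \<open>z\<close>, which has norm 1,
  bounds the sum of \<open>W (z - pt k)\<close> between the frame constants for every
  \<open>z\<close>. The two general counting lemmas then apply.\<close>

lemma gabor_frame_points:
  fixes g :: "real^'m \<Rightarrow> complex" and pt :: "'k \<Rightarrow> (real^'m) \<times> (real^'m)"
  assumes "L2 g" and K: "countable K" and frame: "is_frame_L2 K (gabor_system phi pt g)"
  shows "\<exists>C::nat. \<forall>z. finite {k \<in> K. dist (pt k) z \<le> R} \<and> card {k \<in> K. dist (pt k) z \<le> R} \<le> C"
    and "\<exists>r. \<forall>z. \<exists>k\<in>K. dist (pt k) z \<le> r"
proof -
  have g: "g \<in> borel_measurable lebesgue" and g2: "integrable lebesgue (\<lambda>x. (cmod (g x))\<^sup>2)"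
    using \<open>L2 g\<close> by (auto simp: L2_def)
  obtain h where h [measurable]: "h \<in> borel_measurable borel" and ae: "AE x in lborel. g x = h x"
    using borel_representative[OF g] by blast
  have "integrable lebesgue (\<lambda>x. (cmod (h x))\<^sup>2)"
  proof (rule integrable_cong_AE_imp[OF g2])
    show "(\<lambda>x. (cmod (h x))\<^sup>2) \<in> borel_measurable lebesgue"
      by (rule measurable_completion) measurable
    show "AE x in lebesgue. (cmod (g x))\<^sup>2 = (cmod (h x))\<^sup>2"
      using AE_completion[OF ae] by eventually_elim simp
  qed
  then have h2: "integrable lborel (\<lambda>x. (cmod (h x))\<^sup>2)"
    by (subst (asm) integrable_completion) auto
  define W where "W u = ennreal ((cmod (stft h u))\<^sup>2)" for u
  have W [measurable]: "W \<in> borel_measurable borel" unfolding W_def by measurable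
  have int: "(\<integral>\<^sup>+u. W u \<partial>lborel) < \<infinity>" unfolding W_def by (rule nn_integral_stft_finite[OF h h2])
  obtain A B where "0 < A" and AB: "\<And>f. L2 f \<Longrightarrow>
      (\<lambda>k. (cmod (L2_inner f (gabor_system phi pt g k)))\<^sup>2) summable_on K \<and>
      A * L2_normsq f \<le> (\<Sum>\<^sub>\<infinity>k\<in>K. (cmod (L2_inner f (gabor_system phi pt g k)))\<^sup>2) \<and>
      (\<Sum>\<^sub>\<infinity>k\<in>K. (cmod (L2_inner f (gabor_system phi pt g k)))\<^sup>2) \<le> B * L2_normsq f"
    using frame unfolding is_frame_L2_def by blast
  have "ennreal A \<le> (\<integral>\<^sup>+k. W (z - pt k) \<partial>count_space K) \<and>
      (\<integral>\<^sup>+k. W (z - pt k) \<partial>count_space K) \<le> ennreal B" for z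
  proof -
    let ?f = "tf_shift 0 z pulse"
    let ?s = "\<lambda>k. (cmod (L2_inner ?f (gabor_system phi pt g k)))\<^sup>2"
    have "?s k = (cmod (stft h (z - pt k)))\<^sup>2" if "k \<in> K" for k
      using frame that cmod_L2_inner_tf_shift[OF h ae]
      unfolding gabor_system_def is_frame_L2_def by auto
    then have "(\<integral>\<^sup>+k. W (z - pt k) \<partial>count_space K) = (\<integral>\<^sup>+k. ennreal (?s k) \<partial>count_space K)"
      unfolding W_def by (intro nn_integral_cong) auto
    also have "\<dots> = ennreal (\<Sum>\<^sub>\<infinity>k\<in>K. ?s k)"
      using AB[OF L2_tf_shift_pulse(1)]
      by (intro ennreal_infsum_eq_nn_integral_count_space[symmetric] K) auto
    finally show ?thesis
      using AB[OF L2_tf_shift_pulse(1), of z] by (auto simp: L2_tf_shift_pulse intro: ennreal_leI)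
  qed
  then have lower: "\<And>z. ennreal A \<le> (\<integral>\<^sup>+k. W (z - pt k) \<partial>count_space K)"
    and upper: "\<And>z. (\<integral>\<^sup>+k. W (z - pt k) \<partial>count_space K) \<le> ennreal B" by auto
  have cnt: "\<exists>C::nat. \<forall>z. finite {k \<in> K. dist (pt k) z \<le> R} \<and> card {k \<in> K. dist (pt k) z \<le> R} \<le> C" for R
    by (rule uniformly_locally_finite_if_bounded_sum[OF W int K _ _ lower upper]) (use \<open>0 < A\<close> in auto)
  then show "\<exists>C::nat. \<forall>z. finite {k \<in> K. dist (pt k) z \<le> R} \<and> card {k \<in> K. dist (pt k) z \<le> R} \<le> C" .
  obtain C where C: "\<And>z. finite {k \<in> K. dist (pt k) z \<le> 1} \<and> card {k \<in> K. dist (pt k) z \<le> 1} \<le> C"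
    using cnt by blast
  show "\<exists>r. \<forall>z. \<exists>k\<in>K. dist (pt k) z \<le> r"
    by (rule relatively_dense_if_sum_bounded_below[OF W int K _ lower C]) (use \<open>0 < A\<close> in auto)
qed

theorem theorem9p2:
  fixes g :: "real^'m \<Rightarrow> complex"
    and K :: "'k set"
    and pt :: "'k \<Rightarrow> (real^'m) \<times> (real^'m)"
    and phi :: "'k \<Rightarrow> real"
    and c0 :: "(real^'m) \<times> (real^'m)"
    and M :: "(real^'m) \<times> (real^'m) \<Rightarrow> (real^'m) \<times> (real^'m)"
  assumes "L2 g"
    and "countable K"
    and "is_frame_L2 K (gabor_system phi pt g)"
    and "linear M" and "bij M"
  shows "uniform_metric_index_set K (\<lambda>k k'. supnorm_tf (pt k - pt k'))
           (\<lambda>n. {k \<in> K. pt k \<in> M ` cubeQ n c0})"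
proof -
  let ?N = "supnorm_tf :: (real^'m) \<times> (real^'m) \<Rightarrow> real"
  note cnt = gabor_frame_points(1)[OF assms(1-3)]
  obtain r where r: "\<And>z. \<exists>k\<in>K. dist (pt k) z \<le> r"
    using gabor_frame_points(2)[OF assms(1-3)] by blast
  define L where "L = inv M"
  have M_L: "M (L x) = x" and L_M: "L (M x) = x" for x
    using \<open>bij M\<close> by (simp_all add: L_def bij_is_surj surj_f_inv_f bij_is_inj inv_f_f)
  have "linear L"
    unfolding L_def using assms(4,5) by (simp add: bij_is_inj bij_is_surj inj_linear_imp_inv_linear)
  obtain bM where bM: "0 < bM" "\<And>x. norm (M x) \<le> bM * norm x"
    using linear_bounded_pos[OF \<open>linear M\<close>] by blast
  obtain bL where bL: "0 < bL" "\<And>x. norm (L x) \<le> bL * norm x"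
    using linear_bounded_pos[OF \<open>linear L\<close>] by blast
  define c where "c = 2 * real CARD('m)"
  have c: "0 \<le> c" "norm p \<le> c * ?N p" for p
    using norm_le_supnorm_tf[of p] by (auto simp: c_def)
  \<comment> \<open>Pulling the points back by \<open>M\<close> turns the parallelepipeds into cubes
    centred at \<open>c0\<close>, as the shell estimate requires. Index distances are still measured
    with \<open>pt\<close>; \<open>bM\<close>, \<open>bL\<close> and \<open>c\<close> convert
    between the two.\<close>
  define q where "q k = L (pt k)" for k
  have L_le: "?N (L x) \<le> bL * norm x" for x
    using supnorm_tf_le_norm[of "L x"] bL(2)[of x] by linarith
  define Kn where "Kn n = {k \<in> K. ?N (q k - c0) \<le> real n / 2}" for n :: nat
  have Kn: "{k \<in> K. pt k \<in> M ` cubeQ n c0} = Kn n" for n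
  proof -
    have "pt k \<in> M ` cubeQ n c0 \<longleftrightarrow> q k \<in> cubeQ n c0" for k
      by (metis (no_types, lifting) L_M M_L image_iff q_def)
    then show ?thesis by (auto simp: Kn_def cubeQ_def)
  qed
  have q_cnt: "\<exists>C. \<forall>z. finite {k \<in> K. ?N (q k - z) \<le> R} \<and> card {k \<in> K. ?N (q k - z) \<le> R} \<le> C" for R
  proof -
    obtain C where C: "\<And>z. finite {k \<in> K. dist (pt k) z \<le> bM * (c * R)} \<and>
        card {k \<in> K. dist (pt k) z \<le> bM * (c * R)} \<le> C" using cnt by blast
    \<comment> \<open>A sup-norm ball around \<open>z\<close> is mapped into a Euclidean ball around
      \<open>M z\<close>; the bound \<open>C\<close> is uniform in the centre.\<close>
    have "{k \<in> K. ?N (q k - z) \<le> R} \<subseteq> {k \<in> K. dist (pt k) (M z) \<le> bM * (c * R)}" for z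
    proof safe
      fix k assume "?N (q k - z) \<le> R"
      then have "c * ?N (q k - z) \<le> c * R" using c(1) by (rule mult_left_mono)
      then have "norm (q k - z) \<le> c * R" using c(2) order_trans by blast
      then have "bM * norm (q k - z) \<le> bM * (c * R)" using bM(1) by simp
      moreover have "pt k - M z = M (q k - z)"
        by (simp add: q_def linear_diff[OF \<open>linear M\<close>] M_L)
      ultimately show "dist (pt k) (M z) \<le> bM * (c * R)"
        using bM(2)[of "q k - z"] by (simp add: dist_norm)
    qed
    then show ?thesis using C by (meson card_mono finite_subset order_trans)
  qed
  have q_dense: "\<exists>s. \<forall>z. \<exists>k\<in>K. ?N (q k - z) \<le> s"
  proof (intro exI allI)
    fix z
    obtain k where k: "k \<in> K" "dist (pt k) (M z) \<le> r" using r by blast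
    have "?N (L (pt k - M z)) \<le> bL * norm (pt k - M z)" by (rule L_le)
    also have "\<dots> \<le> bL * r" using k bL(1) by (simp add: dist_norm)
    also have "L (pt k - M z) = q k - z" by (simp add: q_def linear_diff[OF \<open>linear L\<close>] L_M)
    finally show "\<exists>k\<in>K. ?N (q k - z) \<le> bL * r" using k by blast
  qed
  have fin: "finite {k \<in> K. ?N (q k - z) \<le> R}" for z R using q_cnt by blast
  show ?thesis
    unfolding uniform_metric_index_set_def Kn
  proof (intro conjI allI impI)
    show "quasi_distance_on K (\<lambda>k k'. ?N (pt k - pt k'))"
      unfolding quasi_distance_on_def
    proof (intro conjI ballI)
      fix k1 k2 k3
      show "?N (pt k1 - pt k3) \<le> ?N (pt k1 - pt k2) + ?N (pt k2 - pt k3)"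
        using supnorm_tf_triangle[of "pt k1 - pt k2" "pt k2 - pt k3"] by simp
    next
      fix k show "?N (pt k - pt k) = 0" using supnorm_tf_scaleR[of 0 0] by simp
    qed (rule supnorm_tf_nonneg supnorm_tf_minus_commute)+
    show "finite (Kn n)" for n unfolding Kn_def by (rule fin)
    show "Kn n \<subseteq> Kn (Suc n)" for n unfolding Kn_def by auto
    show "(\<Union>n. Kn n) = K"
    proof -
      have "\<exists>n. k \<in> Kn n" if "k \<in> K" for k
      proof -
        \<comment> \<open>The factor 2 appears because the cube with parameter \<open>n\<close> has
          half-side \<open>n / 2\<close>.\<close>
        obtain n :: nat where "?N (q k - c0) * 2 \<le> real n" using real_arch_simple by blast
        then show ?thesis using that by (auto simp: Kn_def)
      qed
      then show ?thesis by (auto simp: Kn_def)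
    qed
  next
    fix R :: real assume "0 < R"
    obtain C where C: "\<And>z. finite {k \<in> K. dist (pt k) z \<le> c * R} \<and>
        card {k \<in> K. dist (pt k) z \<le> c * R} \<le> C" using cnt by blast
    have "ball_idx K (\<lambda>k k'. ?N (pt k - pt k')) R k \<subseteq> {k' \<in> K. dist (pt k') (pt k) \<le> c * R}" for k
    proof (clarsimp simp: ball_idx_def)
      fix k' assume "?N (pt k' - pt k) \<le> R"
      then have "c * ?N (pt k' - pt k) \<le> c * R" using c(1) by (rule mult_left_mono)
      then show "dist (pt k') (pt k) \<le> c * R"
        using c(2)[of "pt k' - pt k"] by (simp add: dist_norm)
    qed
    then show "\<exists>C::nat. \<forall>k\<in>K. finite (ball_idx K (\<lambda>k k'. ?N (pt k - pt k')) R k) \<and>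
        card (ball_idx K (\<lambda>k k'. ?N (pt k - pt k')) R k) \<le> C"
      using C by (meson card_mono finite_subset order_trans)
    \<comment> \<open>Points at sup distance at most \<open>R\<close> are at sup distance at most
      \<open>R'\<close> after the pull-back.\<close>
    define R' where "R' = bL * (c * R)"
    have "0 \<le> R'" using bL c(1) \<open>0 < R\<close> by (simp add: R'_def)
    let ?S = "\<lambda>n. {k \<in> K. real n / 2 - R' < ?N (q k - c0) \<and> ?N (q k - c0) \<le> real n / 2}"
    \<comment> \<open>The outside neighbour \<open>j\<close> lies at level above
      \<open>n / 2\<close>, so \<open>k\<close> lies less than \<open>R'\<close> below that
      level.\<close>
    have sub: "(\<Union>j\<in>K - Kn n. ball_idx K (\<lambda>k k'. ?N (pt k - pt k')) R j) \<inter> Kn n \<subseteq> ?S n" for n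
    proof
      fix k assume "k \<in> (\<Union>j\<in>K - Kn n. ball_idx K (\<lambda>k k'. ?N (pt k - pt k')) R j) \<inter> Kn n"
      then obtain j where j: "j \<in> K" "j \<notin> Kn n" "?N (pt k - pt j) \<le> R" and k: "k \<in> K" "k \<in> Kn n"
        by (auto simp: ball_idx_def)
      have "?N (L (pt j - pt k)) \<le> bL * norm (pt j - pt k)" by (rule L_le)
      also have "\<dots> \<le> bL * (c * ?N (pt j - pt k))"
        using bL(1) c(2)[of "pt j - pt k"] by simp
      also have "\<dots> \<le> R'"
        unfolding R'_def using bL(1) c(1) j(3) by (simp add: supnorm_tf_minus_commute mult_left_mono)
      finally have "?N (q j - q k) \<le> R'" by (simp add: q_def linear_diff[OF \<open>linear L\<close>])
      moreover have "?N (q j - c0) \<le> ?N (q j - q k) + ?N (q k - c0)"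
        using supnorm_tf_triangle[of "q j - q k" "q k - c0"] by simp
      ultimately show "k \<in> ?S n" using j k by (auto simp: Kn_def)
    qed
    show "(\<lambda>n. real (card ((\<Union>j\<in>K - Kn n. ball_idx K (\<lambda>k k'. ?N (pt k - pt k')) R j) \<inter> Kn n))
        / real (card (Kn n))) \<longlonglongrightarrow> 0"
    proof (rule tendsto_sandwich[where f = "\<lambda>_. 0"])
      show "(\<lambda>n. real (card (?S n)) / real (card (Kn n))) \<longlonglongrightarrow> 0"
        unfolding Kn_def
        by (rule shell_ratio_tendsto_0[OF supnorm_tf_triangle supnorm_tf_scaleR q_cnt q_dense \<open>0 \<le> R'\<close>])
      have "finite (?S n)" for n by (rule finite_subset[OF _ fin[of c0 "real n / 2"]]) auto
      then have "card ((\<Union>j\<in>K - Kn n. ball_idx K (\<lambda>k k'. ?N (pt k - pt k')) R j) \<inter> Kn n) \<le> card (?S n)" for n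
        by (rule card_mono[OF _ sub])
      then show "\<forall>\<^sub>F n in sequentially. real (card ((\<Union>j\<in>K - Kn n. ball_idx K (\<lambda>k k'. ?N (pt k - pt k')) R j) \<inter> Kn n))
          / real (card (Kn n)) \<le> real (card (?S n)) / real (card (Kn n))"
        by (intro always_eventually allI divide_right_mono of_nat_mono) auto
    qed auto
  qed (rule assms)
qed

end
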